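(* Let $G$ be a finite nilpotent group and let $\pi(G)$ denote the set of prime divisors of $|G|$. (1) If $|\pi(G)|\geq 3$ and all Sylow subgroups of $G$ are cyclic, then $D(G)$ is perfect. (2) If $|\pi(G)|\geq 3$ and at least one Sylow subgroup of $G$ is non-cyclic, then $D(G)$ is not perfect. (3) If $|\pi(G)|=2$, then $D(G)$ is a comparability graph (of some strict partial order on its vertex set), and hence perfect.
   Context: For a group $G$, the power graph $\mathsf{Pow}(G)$ has vertex set $G$, with distinct $a,b$ adjacent iff $a\in\langle b\rangle$ or $b\in\langle a\rangle$. The enhanced power graph $\mathsf{EPow}(G)$ has vertex set $G$, with distinct $a,b$ adjacent iff $\langle a,b\rangle$ is cyclic. The difference graph $D(G)$ is the graph $\mathsf{EPow}(G)-\mathsf{Pow}(G)$ with all isolated vertices removed; thus $x\sim y$ in $D(G)$ iff $\langle x,y\rangle$ is cyclic, $x\notin\langle y\rangle$ and $y\notin\langle x\rangle$. *)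

theory Defs
  imports
    "HOL-Algebra.Elementary_Groups"
    "HOL-Computational_Algebra.Primes"
    "Graph_Theory.Digraph_Component"
begin

section \<open>Group theory\<close>

primrec lower_central_series :: "('a, 'b) monoid_scheme \<Rightarrow> nat \<Rightarrow> 'a set" where
  "lower_central_series G 0 = carrier G"
| "lower_central_series G (Suc n) = generate G
     (\<Union>x \<in> lower_central_series G n. \<Union>y \<in> carrier G.
        {x \<otimes>\<^bsub>G\<^esub> y \<otimes>\<^bsub>G\<^esub> inv\<^bsub>G\<^esub> x \<otimes>\<^bsub>G\<^esub> inv\<^bsub>G\<^esub> y})"

definition nilpotent_group :: "('a, 'b) monoid_scheme \<Rightarrow> bool" where
  "nilpotent_group G \<longleftrightarrow> group G \<and> (\<exists>n. lower_central_series G n = {\<one>\<^bsub>G\<^esub>})"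

definition prime_divisors :: "('a, 'b) monoid_scheme \<Rightarrow> nat set" where
  "prime_divisors G = {p. prime p \<and> p dvd order G}"

definition sylow_subgroup :: "nat \<Rightarrow> 'a set \<Rightarrow> ('a, 'b) monoid_scheme \<Rightarrow> bool" where
  "sylow_subgroup p P G \<longleftrightarrow> subgroup P G \<and> card P = p ^ multiplicity p (order G)"


section \<open>Perfect graphs and comparability graphs\<close>

text \<open>
  An undirected simple graph is a symmetric loop-free digraph (locale \<^locale>\<open>graph\<close>),
  each edge being a pair of opposite arcs.
\<close>

definition colourable :: "('a, 'b) pre_digraph \<Rightarrow> nat \<Rightarrow> bool" where
  "colourable X k \<longleftrightarrow>
     (\<exists>f :: 'a \<Rightarrow> nat. f ` verts X \<subseteq> {..<k} \<and> (\<forall>(u, v) \<in> arcs_ends X. f u \<noteq> f v))"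

definition chromatic_number :: "('a, 'b) pre_digraph \<Rightarrow> nat" where
  "chromatic_number X = (LEAST k. colourable X k)"

definition is_clique :: "('a, 'b) pre_digraph \<Rightarrow> 'a set \<Rightarrow> bool" where
  "is_clique X K \<longleftrightarrow>
     K \<subseteq> verts X \<and> (\<forall>u \<in> K. \<forall>v \<in> K. u \<noteq> v \<longrightarrow> (u, v) \<in> arcs_ends X)"

definition clique_number :: "('a, 'b) pre_digraph \<Rightarrow> nat" where
  "clique_number X = Max (card ` {K. is_clique X K})"

definition perfect_graph :: "('a, 'b) pre_digraph \<Rightarrow> bool" where
  "perfect_graph X \<longleftrightarrow>
     (\<forall>H. induced_subgraph H X \<longrightarrow> chromatic_number H = clique_number H)"

definition comparability_graph :: "('a, 'b) pre_digraph \<Rightarrow> bool" where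
  "comparability_graph X \<longleftrightarrow>
     (\<exists>r. r \<subseteq> verts X \<times> verts X \<and> irrefl r \<and> trans r \<and> arcs_ends X = r \<union> r\<inverse>)"


section \<open>The difference graph of a group\<close>

definition power_graph :: "('a, 'b) monoid_scheme \<Rightarrow> 'a pair_pre_digraph" where
  "power_graph G = \<lparr> pverts = carrier G,
     parcs = {(a, b). a \<in> carrier G \<and> b \<in> carrier G \<and> a \<noteq> b \<and>
                      (a \<in> generate G {b} \<or> b \<in> generate G {a})} \<rparr>"

definition enhanced_power_graph :: "('a, 'b) monoid_scheme \<Rightarrow> 'a pair_pre_digraph" where
  "enhanced_power_graph G = \<lparr> pverts = carrier G,
     parcs = {(a, b). a \<in> carrier G \<and> b \<in> carrier G \<and> a \<noteq> b \<and>
                      cyclic_group (subgroup_generated G {a, b})} \<rparr>"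

definition edge_difference ::
    "'a pair_pre_digraph \<Rightarrow> 'a pair_pre_digraph \<Rightarrow> 'a pair_pre_digraph" where
  "edge_difference X Y = \<lparr> pverts = pverts X, parcs = parcs X - parcs Y \<rparr>"

definition remove_isolated :: "'a pair_pre_digraph \<Rightarrow> 'a pair_pre_digraph" where
  "remove_isolated X =
     \<lparr> pverts = {v \<in> pverts X. \<exists>u. (u, v) \<in> parcs X \<or> (v, u) \<in> parcs X}, parcs = parcs X \<rparr>"

definition difference_graph :: "('a, 'b) monoid_scheme \<Rightarrow> 'a pair_pre_digraph" where
  "difference_graph G =
     remove_isolated (edge_difference (enhanced_power_graph G) (power_graph G))"

lemma (in group) difference_graph_adj:
  "(x, y) \<in> parcs (difference_graph G) \<longleftrightarrow>
     x \<in> carrier G \<and> y \<in> carrier G \<and> cyclic_group (subgroup_generated G {x, y}) \<and>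
     x \<notin> generate G {y} \<and> y \<notin> generate G {x}"
  by (auto simp: difference_graph_def remove_isolated_def edge_difference_def
      enhanced_power_graph_def power_graph_def intro: generate.incl)

lemma (in group) pair_graph_difference_graph:
  assumes "finite (carrier G)"
  shows "pair_graph (difference_graph G)"
proof -
  let ?D = "difference_graph G"
  have wf: "u \<in> pverts ?D \<and> v \<in> pverts ?D" if "(u, v) \<in> parcs ?D" for u v
    using that by (auto simp: difference_graph_def remove_isolated_def edge_difference_def
        enhanced_power_graph_def)
  have "pverts ?D \<subseteq> carrier G"
    by (auto simp: difference_graph_def remove_isolated_def edge_difference_def
        enhanced_power_graph_def)
  then have fin: "finite (pverts ?D)"
    using assms finite_subset by blast
  have "parcs ?D \<subseteq> pverts ?D \<times> pverts ?D"
    using wf by auto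
  then have fin': "finite (parcs ?D)"
    using fin finite_subset by blast
  have "sym (parcs ?D)"
    by (rule symI) (simp add: difference_graph_adj insert_commute)
  moreover have "u \<noteq> v" if "(u, v) \<in> parcs ?D" for u v
    using that by (auto simp: difference_graph_adj intro: generate.incl)
  ultimately show ?thesis
    using wf fin fin' by unfold_locales (auto simp: symmetric_def)
qed

end

(*
In a finite nilpotent group elements of coprime orders commute, so cyclicity of <x, y> and membership
x in <y> can be tested on the p-parts for each prime p separately, and in a cyclic p-group any two
elements are comparable under x in <y>.
With two primes p and q, adjacency therefore means that the p-parts compare strictly in one direction
and the q-parts strictly in the other; orienting along the p-parts gives a strict partial order.
If all Sylow subgroups are cyclic, so is the group, and D(G) is the incomparability graph of the
preorder x in <y>, hence perfect by Dilworth.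
If a Sylow p-subgroup is not cyclic, it contains incomparable a and b; with nontrivial c of q-power
order and d of r-power order, the elements ac, cd, bd, c, d induce a 5-cycle.
*)
theory Submission
  imports Defs "HOL-Algebra.Sylow" "HOL-Algebra.Multiplicative_Group"
begin

section \<open>Colourings and cliques\<close>

text \<open>The Sylow decomposition of a nilpotent group is never formed. The p-part of
  \<open>x\<close> is a power of \<open>x\<close>, with a Bezout exponent that is 1 modulo the
  p-part of the group order and 0 modulo the rest, so it stays inside the cyclic group of
  \<open>x\<close>. Nilpotency enters only through the commutation of elements of coprime orders,
  which is extracted from the lower central series. Cyclicity of \<langle>x, y\<rangle> is traded
  for the existence of a common cyclic overgroup, so that a single element witnesses it. Membership
  in cyclic subgroups is only a preorder, because distinct generators of one cyclic group lie below
  each other; Dilworth's theorem is therefore proved for preorders. Perfectness is always certified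
  by a clique and a colouring of equal size. In the 5-cycle, ac and bd form the only non-edge that
  is due to the lack of a common cyclic overgroup; the other four non-edges are containments of a
  factor in the group of its product.\<close>

lemma arcs_ends_induced_subgraph:
  assumes "induced_subgraph H X"
  shows "arcs_ends H = {(u, v) \<in> arcs_ends X. u \<in> verts H \<and> v \<in> verts H}"
  using assms
  by (auto simp: induced_subgraph_def subgraph_def compatible_def arcs_ends_conv)

lemma verts_induced_subgraph: "induced_subgraph H X \<Longrightarrow> verts H \<subseteq> verts X"
  by (auto simp: induced_subgraph_def subgraph_def)

lemma card_clique_le_colours:
  assumes "colourable X k" "is_clique X K"
  shows "card K \<le> k"
proof -
  obtain f :: "'a \<Rightarrow> nat" where f: "f ` verts X \<subseteq> {..<k}" "\<forall>(u, v) \<in> arcs_ends X. f u \<noteq> f v"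
    using assms(1) by (auto simp: colourable_def)
  have "inj_on f K"
    using assms(2) f(2) by (fastforce simp: inj_on_def is_clique_def)
  moreover have "f ` K \<subseteq> {..<k}"
    using assms(2) f(1) by (auto simp: is_clique_def)
  ultimately show ?thesis
    using card_inj_on_le[of f K "{..<k}"] by simp
qed

text \<open>A colouring is injective on every clique, so a clique and a colouring of the same size
  certify each other as optimal. Both Mirsky's and Dilworth's arguments end here.\<close>

lemma chromatic_number_eq_clique_number:
  assumes "finite (verts X)" "is_clique X K" "colourable X (card K)"
  shows "chromatic_number X = clique_number X"
proof -
  have "finite {K. is_clique X K}"
    using assms(1) by (rule_tac finite_subset[of _ "Pow (verts X)"]) (auto simp: is_clique_def)
  then have "clique_number X = card K"
    unfolding clique_number_def using assms card_clique_le_colours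
    by (intro Max_eqI) auto
  moreover have "chromatic_number X = card K"
    unfolding chromatic_number_def using assms card_clique_le_colours
    by (intro Least_equality) auto
  ultimately show ?thesis
    by simp
qed

section \<open>The five-cycle as an obstruction to perfectness\<close>

lemma colourable_mono: "colourable X k \<Longrightarrow> k \<le> l \<Longrightarrow> colourable X l"
  unfolding colourable_def by (meson lessThan_subset_iff subset_trans)

text \<open>\<open>chromatic_number\<close> is a \<open>LEAST\<close>, hence attained only once some
  colouring is known to exist; one colour per vertex provides it.\<close>

lemma colourable_card_verts:
  assumes "finite (verts X)" "\<forall>(u, v) \<in> arcs_ends X. u \<noteq> v \<and> u \<in> verts X \<and> v \<in> verts X"
  shows "colourable X (card (verts X))"
proof -
  obtain f :: "'a \<Rightarrow> nat" where "bij_betw f (verts X) {..<card (verts X)}"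
    using ex_bij_betw_finite_nat[OF assms(1)] atLeast0LessThan by auto
  then have "f ` verts X \<subseteq> {..<card (verts X)}" "inj_on f (verts X)"
    by (auto simp: bij_betw_def)
  then show ?thesis
    using assms(2) unfolding colourable_def by (fastforce simp: inj_on_def)
qed

text \<open>Among three distinct positions on a 5-cycle two are not consecutive. Each of the 125
  assignments of \<open>x\<close>, \<open>y\<close>, \<open>z\<close> to positions therefore meets a
  loop or a chord; the chords are listed in both directions because \<open>E\<close> is not assumed
  symmetric.\<close>

lemma C5_triangle_free:
  assumes adj: "(x, y) \<in> E" "(y, z) \<in> E" "(x, z) \<in> E" and V: "{x, y, z} \<subseteq> {v1, v2, v3, v4, v5}"
    and irrefl: "\<And>u. (u, u) \<notin> E"
    and chords: "(v1, v3) \<notin> E" "(v1, v4) \<notin> E" "(v2, v4) \<notin> E" "(v2, v5) \<notin> E" "(v3, v5) \<notin> E"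
    "(v3, v1) \<notin> E" "(v4, v1) \<notin> E" "(v4, v2) \<notin> E" "(v5, v2) \<notin> E" "(v5, v3) \<notin> E"
  shows False
proof -
  have "x \<in> {v1, v2, v3, v4, v5}" "y \<in> {v1, v2, v3, v4, v5}" "z \<in> {v1, v2, v3, v4, v5}"
    using V by auto
  then show False
    by (elim insertE emptyE; use adj irrefl chords in \<open>hypsubst_thin, simp only: simp_thms\<close>)
qed

text \<open>Without triangles the clique number is at most 2, so perfectness would yield a
  2-colouring, and two colours cannot alternate around an odd cycle.\<close>

lemma (in graph) not_perfect_if_induced_C5:
  assumes verts: "{v1, v2, v3, v4, v5} \<subseteq> verts G"
    and cycle: "(v1, v2) \<in> arcs_ends G" "(v2, v3) \<in> arcs_ends G" "(v3, v4) \<in> arcs_ends G"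
      "(v4, v5) \<in> arcs_ends G" "(v5, v1) \<in> arcs_ends G"
    and chords: "(v1, v3) \<notin> arcs_ends G" "(v1, v4) \<notin> arcs_ends G" "(v2, v4) \<notin> arcs_ends G"
      "(v2, v5) \<notin> arcs_ends G" "(v3, v5) \<notin> arcs_ends G"
  shows "\<not> perfect_graph G"
proof
  let ?V = "{v1, v2, v3, v4, v5}"
  let ?H = "G \<restriction> ?V"
  assume perfect: "perfect_graph G"
  have ind: "induced_subgraph ?H G"
    using verts by (rule induced_induce)
  have sym: "(v, u) \<in> arcs_ends G" if "(u, v) \<in> arcs_ends G" for u v
    using that sym_arcs by (meson symD symmetric_def)
  have irrefl: "(u, u) \<notin> arcs_ends G" for u
    using no_loops by (auto simp: arcs_ends_conv)
  have arcs: "arcs_ends ?H = {(u, v) \<in> arcs_ends G. u \<in> ?V \<and> v \<in> ?V}"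
    using arcs_ends_induced_subgraph[OF ind] by simp
  have "\<exists>k. colourable ?H k"
  proof -
    have "\<forall>(u, v) \<in> arcs_ends ?H. u \<noteq> v \<and> u \<in> verts ?H \<and> v \<in> verts ?H"
      using irrefl unfolding arcs by auto
    then show ?thesis
      using colourable_card_verts[of ?H] by auto
  qed
  then have "colourable ?H (chromatic_number ?H)"
    unfolding chromatic_number_def by (rule LeastI_ex)
  then have "colourable ?H (clique_number ?H)"
    using perfect ind by (simp add: perfect_graph_def)
  moreover have "clique_number ?H \<le> 2"
  proof -
    have "card K \<le> 2" if K: "is_clique ?H K" for K
    proof (rule ccontr)
      assume "\<not> card K \<le> 2"
      then obtain T where "T \<subseteq> K" "card T = 3"
        using obtain_subset_with_card_n[of 3 K] by auto
      then obtain x y z where xyz: "x \<in> K" "y \<in> K" "z \<in> K" "x \<noteq> y" "y \<noteq> z" "x \<noteq> z"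
        by (auto simp: card_3_iff)
      have in_V: "p \<in> ?V" if "p \<in> K" for p
        using K that unfolding is_clique_def induce_subgraph_verts by blast
      have "(p, q) \<in> arcs_ends ?H" if "p \<in> K" "q \<in> K" "p \<noteq> q" for p q
        using K that unfolding is_clique_def by blast
      then have "(p, q) \<in> arcs_ends G" if "p \<in> K" "q \<in> K" "p \<noteq> q" for p q
        using that unfolding arcs by blast
      then have adj: "(x, y) \<in> arcs_ends G" "(y, z) \<in> arcs_ends G" "(x, z) \<in> arcs_ends G"
        and V: "{x, y, z} \<subseteq> ?V"
        using xyz in_V by blast+
      have chords': "(v3, v1) \<notin> arcs_ends G" "(v4, v1) \<notin> arcs_ends G" "(v4, v2) \<notin> arcs_ends G"
        "(v5, v2) \<notin> arcs_ends G" "(v5, v3) \<notin> arcs_ends G"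
        using chords sym[of v3 v1] sym[of v4 v1] sym[of v4 v2] sym[of v5 v2] sym[of v5 v3] by auto
      show False
        by (rule C5_triangle_free[OF adj V irrefl chords chords'])
    qed
    moreover have "finite {K. is_clique ?H K}" "is_clique ?H {}"
      by (rule finite_subset[of _ "Pow ?V"]) (auto simp: is_clique_def)
    ultimately show ?thesis
      unfolding clique_number_def by (intro Max.boundedI) auto
  qed
  ultimately have "colourable ?H 2"
    by (rule colourable_mono)
  then obtain f :: "'a \<Rightarrow> nat" where "f ` ?V \<subseteq> {..<2}" "\<forall>(u, v) \<in> arcs_ends ?H. f u \<noteq> f v"
    by (auto simp: colourable_def)
  then have "f v1 < 2" "f v2 < 2" "f v3 < 2" "f v4 < 2" "f v5 < 2"
    "f v1 \<noteq> f v2" "f v2 \<noteq> f v3" "f v3 \<noteq> f v4" "f v4 \<noteq> f v5" "f v5 \<noteq> f v1"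
    using cycle arcs by auto
  then show False
    by linarith
qed

section \<open>Comparability graphs and their complements are perfect\<close>

lemma comparability_graph_induced_subgraph:
  assumes "comparability_graph X" "induced_subgraph H X"
  shows "comparability_graph H"
proof -
  obtain r where r: "r \<subseteq> verts X \<times> verts X" "irrefl r" "trans r" "arcs_ends X = r \<union> r\<inverse>"
    using assms(1) by (auto simp: comparability_graph_def)
  let ?s = "r \<inter> verts H \<times> verts H"
  have "irrefl ?s" "trans ?s"
    using r(2,3) by (auto simp: irrefl_def trans_def)
  moreover have "arcs_ends H = ?s \<union> ?s\<inverse>"
    using arcs_ends_induced_subgraph[OF assms(2)] r(4) by auto
  ultimately show ?thesis
    unfolding comparability_graph_def by (intro exI[of _ ?s]) auto
qed

text \<open>Mirsky: the height function of the order is an optimal colouring.\<close>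

lemma chromatic_number_comparability_graph:
  assumes "comparability_graph X" "finite (verts X)"
  shows "chromatic_number X = clique_number X"
proof -
  obtain r where r: "r \<subseteq> verts X \<times> verts X" "irrefl r" "trans r" "arcs_ends X = r \<union> r\<inverse>"
    using assms(1) by (auto simp: comparability_graph_def)
  \<comment> \<open>Cliques are the chains of \<open>r\<close>. Those in \<open>C v\<close> lie
    strictly below \<open>v\<close> and omit \<open>v\<close> itself, so heights start at 0 and stay
    below the clique number.\<close>
  define C where "C v = {K. is_clique X K \<and> (\<forall>u \<in> K. (u, v) \<in> r)}" for v
  define h where "h v = Max (card ` C v)" for v
  have fin: "finite {K. is_clique X K}"
    using assms(2) by (rule_tac finite_subset[of _ "Pow (verts X)"]) (auto simp: is_clique_def)
  have finC: "finite (C v)" for v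
    using fin by (rule rev_finite_subset) (auto simp: C_def)
  have C0: "{} \<in> C v" for v
    by (auto simp: C_def is_clique_def)
  have clique_fin: "finite K" if "is_clique X K" for K
    using that assms(2) finite_subset by (auto simp: is_clique_def)
  have h_ex: "\<exists>K \<in> C v. card K = h v" for v
    using Max_in[of "card ` C v"] finC C0 unfolding h_def by fastforce
  have ext: "is_clique X (insert v K) \<and> card (insert v K) = Suc (card K)"
    if "K \<in> C v" "v \<in> verts X" for K v
    using that r clique_fin by (auto simp: C_def is_clique_def irrefl_def)
  obtain K where K: "is_clique X K" "card K = clique_number X"
    using Max_in[of "card ` {K. is_clique X K}"] fin C0 unfolding clique_number_def C_def by fastforce
  \<comment> \<open>Adding \<open>v\<close> to a longest chain below it gives a clique with
    \<open>h v + 1\<close> elements.\<close>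
  have "h v < clique_number X" if "v \<in> verts X" for v
  proof -
    obtain K where "K \<in> C v" "card K = h v"
      using h_ex by blast
    then have "Suc (h v) \<in> card ` {K. is_clique X K}"
      using ext[OF _ that] by (metis image_eqI mem_Collect_eq)
    then have "Suc (h v) \<le> clique_number X"
      unfolding clique_number_def using fin by (intro Max_ge) auto
    then show ?thesis
      by simp
  qed
  moreover have less: "h u < h v" if "(u, v) \<in> r" for u v
  proof -
    obtain K where K: "K \<in> C u" "card K = h u"
      using h_ex by blast
    have "u \<in> verts X"
      using that r(1) by auto
    moreover have "insert u K \<in> C v"
      using ext[OF K(1) \<open>u \<in> verts X\<close>] K(1) that r(3) by (auto simp: C_def trans_def)
    ultimately have "Suc (h u) \<in> card ` C v"
      using ext[OF K(1)] K(2) by (metis image_eqI)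
    then have "Suc (h u) \<le> h v"
      unfolding h_def[of v] using finC by (intro Max_ge) auto
    then show ?thesis
      by simp
  qed
  ultimately have "colourable X (card K)"
    unfolding colourable_def K(2) r(4) using less by (intro exI[of _ h]) fastforce
  then show ?thesis
    using chromatic_number_eq_clique_number assms(2) K(1) by blast
qed

lemma perfect_comparability_graph:
  assumes "comparability_graph X" "finite (verts X)"
  shows "perfect_graph X"
  unfolding perfect_graph_def
proof (intro allI impI)
  fix H :: "('a, 'b) pre_digraph"
  assume H: "induced_subgraph H X"
  show "chromatic_number H = clique_number H"
    using comparability_graph_induced_subgraph[OF assms(1) H]
      finite_subset[OF verts_induced_subgraph[OF H] assms(2)]
    by (rule chromatic_number_comparability_graph)
qed

section \<open>Dilworth's theorem for preorders and the perfection of incomparability graphs\<close>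

definition antichain :: "('a \<Rightarrow> 'a \<Rightarrow> bool) \<Rightarrow> 'a set \<Rightarrow> bool" where
  "antichain R A \<longleftrightarrow> (\<forall>x \<in> A. \<forall>y \<in> A. x \<noteq> y \<longrightarrow> \<not> R x y)"

lemma antichainD: "antichain R A \<Longrightarrow> x \<in> A \<Longrightarrow> y \<in> A \<Longrightarrow> R x y \<Longrightarrow> x = y"
  by (auto simp: antichain_def)

lemma antichain_subset: "antichain R A \<Longrightarrow> B \<subseteq> A \<Longrightarrow> antichain R B"
  unfolding antichain_def by (meson subsetD)

text \<open>Galvin's proof: remove a maximal element \<open>a\<close>, and in each chain of an optimal
  decomposition of the rest take the top element lying on a maximum antichain.\<close>

theorem dilworth:
  fixes R :: "'a \<Rightarrow> 'a \<Rightarrow> bool"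
  assumes "finite V"
    and refl: "\<And>x. x \<in> V \<Longrightarrow> R x x"
    and trans: "\<And>x y z. x \<in> V \<Longrightarrow> y \<in> V \<Longrightarrow> z \<in> V \<Longrightarrow> R x y \<Longrightarrow> R y z \<Longrightarrow> R x z"
  shows "\<exists>A f. A \<subseteq> V \<and> antichain R A \<and> f ` V \<subseteq> {..<card A} \<and>
    (\<forall>x \<in> V. \<forall>y \<in> V. f x = (f y :: nat) \<longrightarrow> R x y \<or> R y x)"
  using assms
proof (induction V rule: finite_psubset_induct)
  case (psubset V)
  have IH: "\<exists>A f. A \<subseteq> U \<and> antichain R A \<and> f ` U \<subseteq> {..<card A} \<and>
      (\<forall>x \<in> U. \<forall>y \<in> U. f x = (f y :: nat) \<longrightarrow> R x y \<or> R y x)" if U: "U \<subset> V" for U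
  proof (rule psubset.IH[OF U])
    show "R x x" if "x \<in> U" for x
      using that U psubset.prems(1)[of x] by blast
    show "R x z" if "x \<in> U" "y \<in> U" "z \<in> U" "R x y" "R y z" for x y z
      using that U psubset.prems(2)[of x y z] by blast
  qed
  show ?case
  proof (cases "V = {}")
    case True
    then show ?thesis
      by (intro exI[of _ "{}"]) (auto simp: antichain_def)
  next
    case False
    \<comment> \<open>Maximality in the sense of a preorder: whatever lies above \<open>a\<close> is
      equivalent to \<open>a\<close>. It is stated for all nonempty subsets because it is used for
      \<open>V\<close> and again for each class \<open>W i\<close>.\<close>
    have "\<exists>a \<in> W. \<forall>v \<in> W. R a v \<longrightarrow> R v a" if "finite W" "W \<noteq> {}" "W \<subseteq> V" for W
      using that
    proof (induction W rule: finite_ne_induct)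
      case (singleton x)
      then show ?case by auto
    next
      case (insert x W)
      have "W \<subseteq> V"
        using insert.prems by blast
      then obtain a where a: "a \<in> W" "\<forall>v \<in> W. R a v \<longrightarrow> R v a"
        using insert.IH by blast
      show ?case
      proof (cases "R a x")
        case True
        have "R v x" if "v \<in> W" "R x v" for v
        proof -
          have "x \<in> V" "v \<in> V" "a \<in> V"
            using that a(1) insert.prems by auto
          then show ?thesis
            using psubset.prems(2)[of a x v] psubset.prems(2)[of v a x] True a(2) that by blast
        qed
        then show ?thesis
          by (intro bexI[of _ x]) auto
      next
        case False
        then show ?thesis
          using a by (intro bexI[of _ a]) auto
      qed
    qed
    note maximal = this
    obtain a where a: "a \<in> V" "\<forall>v \<in> V. R a v \<longrightarrow> R v a"
      using maximal[OF psubset.hyps(1) False] by auto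
    let ?V = "V - {a}"
    have "?V \<subset> V"
      using a(1) by auto
    from IH[OF this] obtain A f where A: "A \<subseteq> ?V" "antichain R A"
      and f: "f ` ?V \<subseteq> {..<card A}" "\<forall>x \<in> ?V. \<forall>y \<in> ?V. f x = (f y :: nat) \<longrightarrow> R x y \<or> R y x"
      by (elim exE conjE) (rule that; assumption)
    define k where "k = card A"
    define S where "S = {B. B \<subseteq> ?V \<and> antichain R B \<and> card B = k}"
    \<comment> \<open>An antichain meets each of the \<open>k\<close> colour classes at most once,
      since these are chains; having \<open>k\<close> elements, it meets all of them.\<close>
    have meets: "f ` B = {..<k}" if "B \<in> S" for B
    proof -
      have B: "B \<subseteq> ?V" "antichain R B" "card B = k"
        using that by (auto simp: S_def)
      have "inj_on f B"
      proof (rule inj_onI, rule ccontr)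
        fix x y
        assume xy: "x \<in> B" "y \<in> B" "f x = f y" "x \<noteq> y"
        then have "R x y \<or> R y x"
          using f(2)[rule_format, of x y] B(1) by blast
        then show False
          using antichainD[OF B(2), of x y] antichainD[OF B(2), of y x] xy by auto
      qed
      moreover have "f ` B \<subseteq> {..<k}"
        using B(1) f(1) unfolding k_def by (meson image_mono subset_trans)
      ultimately show ?thesis
        using B(3) by (intro card_subset_eq) (simp_all add: card_image)
    qed
    \<comment> \<open>The part of chain \<open>i\<close> covered by maximum antichains. Being a
      finite chain, it has a top element \<open>t i\<close>.\<close>
    define W where "W i = {x \<in> ?V. f x = i \<and> x \<in> \<Union>S}" for i
    have "\<exists>x. x \<in> W i \<and> (\<forall>y \<in> W i. R y x)" if "i < k" for i
    proof -
      have "A \<in> S"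
        using A unfolding S_def k_def by simp
      then have "i \<in> f ` A"
        using meets that by auto
      then have "W i \<noteq> {}"
        using A \<open>A \<in> S\<close> by (auto simp: W_def)
      then obtain x where x: "x \<in> W i" "\<forall>v \<in> W i. R x v \<longrightarrow> R v x"
        using maximal[of "W i"] psubset.hyps(1) by (auto simp: W_def)
      have "R y x" if "y \<in> W i" for y
      proof -
        have "R x y \<or> R y x"
          using f(2)[rule_format, of x y] x(1) that by (simp add: W_def)
        then show ?thesis
          using x(2) that by blast
      qed
      then show ?thesis
        using x(1) by blast
    qed
    then have "\<forall>i. \<exists>x. i < k \<longrightarrow> x \<in> W i \<and> (\<forall>y \<in> W i. R y x)"
      by simp
    from choice[OF this] obtain t
      where t: "\<And>i. i < k \<Longrightarrow> t i \<in> W i" "\<And>i y. i < k \<Longrightarrow> y \<in> W i \<Longrightarrow> R y (t i)"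
      by auto
    have tV: "t i \<in> ?V" "f (t i) = i" if "i < k" for i
      using t(1)[OF that] by (auto simp: W_def)
    \<comment> \<open>A maximum antichain through \<open>t j\<close> has a member \<open>y\<close>
      in class \<open>i\<close>. It lies below \<open>t i\<close>, so \<open>R (t i) (t j)\<close>
      would put it below \<open>t j\<close>, inside the same antichain.\<close>
    have t_anti: "\<not> R (t i) (t j)" if ij: "i < k" "j < k" "i \<noteq> j" for i j
    proof
      assume le: "R (t i) (t j)"
      obtain B where B: "B \<in> S" "t j \<in> B"
        using t(1)[OF ij(2)] by (auto simp: W_def)
      then obtain y where y: "y \<in> B" "f y = i"
        using meets[OF B(1)] ij(1) by (metis imageE lessThan_iff)
      have yV: "y \<in> ?V" "y \<in> W i"
        using y B by (auto simp: S_def W_def)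
      then have "R y (t j)"
        using t(2)[OF ij(1), of y] le psubset.prems(2)[of y "t i" "t j"] tV[OF ij(1)] tV[OF ij(2)]
        by blast
      moreover have "y \<noteq> t j"
        using y tV ij by auto
      ultimately show False
        using B y antichainD[of R B y "t j"] by (simp add: S_def)
    qed
    let ?T = "t ` {..<k}"
    have T: "?T \<subseteq> ?V" "antichain R ?T" "card ?T = k"
    proof -
      have "inj_on t {..<k}"
        using tV(2) by (metis inj_onI lessThan_iff)
      then show "card ?T = k"
        by (simp add: card_image)
      show "?T \<subseteq> ?V" "antichain R ?T"
        using tV t_anti unfolding antichain_def by auto
    qed
    show ?thesis
    proof (cases "\<exists>i < k. R (t i) a")
      case False
      \<comment> \<open>Since \<open>a\<close> is maximal, \<open>R a (t i)\<close> would give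
        \<open>R (t i) a\<close>, which this case excludes. Thus \<open>a\<close> extends the
        antichain of tops and is given the fresh colour \<open>k\<close>.\<close>
      then have "\<not> R a (t i)" if "i < k" for i
        using a(2) tV that by blast
      then have "antichain R (insert a ?T)"
        using T False unfolding antichain_def by auto
      moreover have "card (insert a ?T) = Suc k"
        using T by (subst card_insert_disjoint) auto
      moreover have "(f(a := k)) ` V \<subseteq> {..<Suc k}"
        using f(1) by (force simp: k_def less_Suc_eq)
      moreover have "R x y \<or> R y x" if "x \<in> V" "y \<in> V" "(f(a := k)) x = (f(a := k)) y" for x y
      proof (cases "x = a \<or> y = a")
        case True
        have "f z < k" if "z \<in> ?V" for z
          using that f(1) by (auto simp: k_def)
        then have "x = y"
          using that True by (cases "x = a"; cases "y = a") force+
        then show ?thesis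
          using psubset.prems(1) that by auto
      next
        case False
        then show ?thesis
          using that f(2) by auto
      qed
      ultimately show ?thesis
        using T(1) a(1) by (intro exI[of _ "insert a ?T"] exI[of _ "f(a := k)"]) auto
    next
      case True
      then obtain i where i: "i < k" "R (t i) a"
        by blast
      \<comment> \<open>The part of chain \<open>i\<close> up to its top \<open>t i\<close>, capped
        by \<open>a\<close>; it is a chain because \<open>t i\<close> lies below
        \<open>a\<close>.\<close>
      define K where "K = insert a {z \<in> ?V. f z = i \<and> R z (t i)}"
      have K_le: "R z a" if "z \<in> K" for z
      proof (cases "z = a")
        case True
        then show ?thesis
          using psubset.prems(1) a(1) by blast
      next
        case False
        then show ?thesis
          using that i a(1) psubset.prems(2)[of z "t i" a] tV(1)[OF i(1)] unfolding K_def by blast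
      qed
      have K_chain: "R x y \<or> R y x" if "x \<in> K" "y \<in> K" for x y
      proof (cases "x = a \<or> y = a")
        case True
        then show ?thesis using that K_le by auto
      next
        case False
        then show ?thesis using that f(2) by (auto simp: K_def)
      qed
      have "V - K \<subset> V"
        using a(1) by (auto simp: K_def)
      from IH[OF this] obtain B g where B: "B \<subseteq> V - K" "antichain R B"
        and g: "g ` (V - K) \<subseteq> {..<card B}"
          "\<forall>x \<in> V - K. \<forall>y \<in> V - K. g x = (g y :: nat) \<longrightarrow> R x y \<or> R y x"
        by (elim exE conjE) (rule that; assumption)
      have BV: "B \<subseteq> ?V"
        using B(1) by (auto simp: K_def)
      \<comment> \<open>An antichain of size \<open>k\<close> avoiding \<open>K\<close> would belong
        to \<open>S\<close> and so have a member in class \<open>i\<close>. That member lies in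
        \<open>W i\<close>, hence below \<open>t i\<close>, hence in \<open>K\<close>.\<close>
      have "card B < k"
      proof (rule ccontr)
        assume "\<not> card B < k"
        then obtain B' where B': "B' \<subseteq> B" "card B' = k"
          using obtain_subset_with_card_n[of k B] by auto
        then have "B' \<in> S"
          using antichain_subset[OF B(2)] BV unfolding S_def by blast
        then obtain y where y: "y \<in> B'" "f y = i"
          using meets i(1) by (metis imageE lessThan_iff)
        then have "y \<in> W i"
          using \<open>B' \<in> S\<close> by (auto simp: W_def S_def)
        then have "y \<in> K"
          using t(2)[OF i(1)] y by (auto simp: K_def W_def)
        then show False
          using B B' y by auto
      qed
      \<comment> \<open>\<open>K\<close> receives the colour \<open>k - 1\<close>, which
        \<open>g\<close> leaves free because \<open>card B < k\<close>; here \<open>i < k\<close>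
        rules out \<open>k = 0\<close>.\<close>
      define h where "h x = (if x \<in> K then k - 1 else g x)" for x
      have g_less: "g x < k - 1" if "x \<in> V - K" for x
        using g(1) that \<open>card B < k\<close> by fastforce
      have "h ` V \<subseteq> {..<card ?T}"
        using g_less i(1) T(3) by (fastforce simp: h_def)
      moreover have "R x y \<or> R y x" if "x \<in> V" "y \<in> V" "h x = h y" for x y
        using that g(2) g_less[of x] g_less[of y] K_chain by (auto simp: h_def split: if_splits)
      ultimately show ?thesis
        using T by (intro exI[of _ ?T] exI[of _ h]) auto
    qed
  qed
qed

text \<open>Antichains are cliques and chains are independent sets here, so Dilworth's decomposition
  is a colouring with as many colours as the antichain has elements. Induced subgraphs inherit the
  hypotheses by restricting \<open>R\<close>.\<close>

lemma perfect_incomparability_graph: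
  assumes "finite (verts X)"
    and refl: "\<And>x. x \<in> verts X \<Longrightarrow> R x x"
    and trans: "\<And>x y z. x \<in> verts X \<Longrightarrow> y \<in> verts X \<Longrightarrow> z \<in> verts X \<Longrightarrow> R x y \<Longrightarrow> R y z \<Longrightarrow> R x z"
    and arcs: "arcs_ends X = {(x, y). x \<in> verts X \<and> y \<in> verts X \<and> \<not> R x y \<and> \<not> R y x}"
  shows "perfect_graph X"
  unfolding perfect_graph_def
proof (intro allI impI)
  fix H :: "('a, 'b) pre_digraph"
  assume H: "induced_subgraph H X"
  have sub: "verts H \<subseteq> verts X" and fin: "finite (verts H)"
    using verts_induced_subgraph[OF H] assms(1) finite_subset by auto
  have arcsH: "arcs_ends H = {(x, y). x \<in> verts H \<and> y \<in> verts H \<and> \<not> R x y \<and> \<not> R y x}"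
    using arcs_ends_induced_subgraph[OF H] arcs sub by auto
  have "\<exists>A f. A \<subseteq> verts H \<and> antichain R A \<and> f ` verts H \<subseteq> {..<card A} \<and>
    (\<forall>x \<in> verts H. \<forall>y \<in> verts H. f x = (f y :: nat) \<longrightarrow> R x y \<or> R y x)"
    using sub by (intro dilworth fin refl) (auto intro: trans)
  then obtain A f where A: "A \<subseteq> verts H" "antichain R A" and f: "f ` verts H \<subseteq> {..<card A}"
    "\<forall>x \<in> verts H. \<forall>y \<in> verts H. f x = (f y :: nat) \<longrightarrow> R x y \<or> R y x"
    by blast
  have "is_clique H A"
    using A(1) antichainD[OF A(2)] unfolding is_clique_def arcsH by auto
  moreover have "colourable H (card A)"
    unfolding colourable_def arcsH using f by (intro exI[of _ f]) auto
  ultimately show "chromatic_number H = clique_number H"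
    using fin chromatic_number_eq_clique_number by blast
qed

section \<open>Nilpotent groups\<close>

context group
begin

text \<open>Needed to form quotients by the terms of the series. A conjugate of a commutator is the
  commutator of the conjugates, so normality passes from one term to the next.\<close>

lemma normal_lower_central_series: "lower_central_series G n \<lhd> G"
proof (induction n)
  case 0
  show ?case
    by (simp add: normal_inv_iff subgroup_self)
next
  case (Suc n)
  let ?L = "lower_central_series G n"
  have sub: "?L \<subseteq> carrier G"
    using Suc.IH normal_imp_subgroup subgroup.subset by blast
  show ?case
    unfolding lower_central_series.simps
  proof (rule normal_generateI)
    show "(\<Union>x \<in> ?L. \<Union>y \<in> carrier G. {x \<otimes> y \<otimes> inv x \<otimes> inv y}) \<subseteq> carrier G"
      using sub by auto
  next
    fix h g
    assume "h \<in> (\<Union>x \<in> ?L. \<Union>y \<in> carrier G. {x \<otimes> y \<otimes> inv x \<otimes> inv y})" and g: "g \<in> carrier G"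
    then obtain x y where x: "x \<in> ?L" and y: "y \<in> carrier G" and h: "h = x \<otimes> y \<otimes> inv x \<otimes> inv y"
      by auto
    have xG: "x \<in> carrier G"
      using x sub by auto
    let ?x = "g \<otimes> x \<otimes> inv g" and ?y = "g \<otimes> y \<otimes> inv g"
    have cancel: "inv g \<otimes> (g \<otimes> z) = z" if "z \<in> carrier G" for z
      using g that by (simp flip: m_assoc)
    have "g \<otimes> h \<otimes> inv g = ?x \<otimes> ?y \<otimes> inv ?x \<otimes> inv ?y"
      using xG y g by (simp add: h m_assoc inv_mult_group cancel)
    moreover have "?x \<in> ?L"
      using Suc.IH x g by (auto simp: normal_inv_iff)
    ultimately show "g \<otimes> h \<otimes> inv g \<in> (\<Union>x \<in> ?L. \<Union>y \<in> carrier G. {x \<otimes> y \<otimes> inv x \<otimes> inv y})"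
      using y g by blast
  qed
qed

section \<open>Commutation of elements of coprime orders in nilpotent groups\<close>

lemma conj_nat_pow:
  assumes "x \<in> carrier G" "y \<in> carrier G"
  shows "(x \<otimes> y \<otimes> inv x) [^] (n :: nat) = x \<otimes> y [^] n \<otimes> inv x"
proof (induction n)
  case (Suc n)
  have "inv x \<otimes> (x \<otimes> z) = z" if "z \<in> carrier G" for z
    using assms that by (simp flip: m_assoc)
  then show ?case
    using Suc assms by (simp add: m_assoc)
qed (use assms in simp)

lemma eq_one_if_coprime_pows:
  assumes "z \<in> carrier G" "z [^] (m :: nat) = \<one>" "z [^] (n :: nat) = \<one>" "coprime m n"
  shows "z = \<one>"
proof -
  have "ord z = 1"
    using assms coprime_common_divisor_nat[of m n "ord z"] by (simp add: pow_eq_id)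
  then show ?thesis
    using assms(1) ord_eq_1 by blast
qed

text \<open>As \<open>z\<close> commutes with \<open>x\<close> and \<open>y\<close>, the n-th power
  of \<open>z \<otimes> y = x \<otimes> y \<otimes> inv x\<close> and the m-th power of
  \<open>inv x \<otimes> z = y \<otimes> inv x \<otimes> inv y\<close> can be taken factor by
  factor; they leave \<open>z [^] n = \<one>\<close> and \<open>z [^] m = \<one>\<close>.\<close>

lemma central_commutator_eq_one:
  assumes xy: "x \<in> carrier G" "y \<in> carrier G"
    and z: "z = x \<otimes> y \<otimes> inv x \<otimes> inv y" "z \<otimes> x = x \<otimes> z" "z \<otimes> y = y \<otimes> z"
    and pows: "x [^] (m :: nat) = \<one>" "y [^] (n :: nat) = \<one>" "coprime m n"
  shows "z = \<one>"
proof (rule eq_one_if_coprime_pows)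
  show zG: "z \<in> carrier G"
    using xy z(1) by simp
  have "z \<otimes> y = x \<otimes> y \<otimes> inv x"
    using xy z(1) by (simp add: m_assoc)
  then have "z [^] n \<otimes> y [^] n = x \<otimes> y [^] n \<otimes> inv x"
    using pow_mult_distrib[OF z(3) zG xy(2), of n] conj_nat_pow[OF xy, of n] by simp
  then show "z [^] n = \<one>"
    using xy zG pows by simp
  have "y \<otimes> inv x \<otimes> inv y = inv x \<otimes> z"
    using xy z(1) by (simp add: m_assoc inv_solve_left)
  moreover have "inv x \<otimes> z = z \<otimes> inv x"
    using z(2) zG xy by (metis inv_closed inv_solve_left inv_solve_right m_assoc m_closed)
  ultimately have "inv x [^] m \<otimes> z [^] m = y \<otimes> inv x [^] m \<otimes> inv y"
    using pow_mult_distrib[of "inv x" z m] conj_nat_pow[of y "inv x" m] xy zG by simp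
  then show "z [^] m = \<one>"
    using xy zG pows by (simp add: nat_pow_inv)
qed (use pows(3) in \<open>simp add: coprime_commute\<close>)

text \<open>The commutator lies in every term of the lower central series: modulo the next
  term it is central, so its order divides both \<open>m\<close> and \<open>n\<close>.\<close>

lemma nilpotent_coprime_commute:
  assumes nil: "nilpotent_group G"
    and xy: "x \<in> carrier G" "y \<in> carrier G"
    and pows: "x [^] (m :: nat) = \<one>" "y [^] (n :: nat) = \<one>" "coprime m n"
  shows "x \<otimes> y = y \<otimes> x"
proof -
  let ?z = "x \<otimes> y \<otimes> inv x \<otimes> inv y"
  have zG: "?z \<in> carrier G"
    using xy by simp
  have "?z \<in> lower_central_series G i" for i
  proof (induction i)
    case 0
    then show ?case using zG by simp
  next
    case (Suc i)
    define N where "N = lower_central_series G (Suc i)"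
    interpret N: normal N G
      unfolding N_def by (rule normal_lower_central_series)
    interpret Q: group "G Mod N"
      by (rule N.factorgroup_is_group)
    interpret hom: group_hom G "G Mod N" "\<lambda>a. N #> a"
      by unfold_locales (rule N.r_coset_hom_Mod)
    \<comment> \<open>By the induction hypothesis \<open>?z\<close> lies in term \<open>i\<close>,
      so its commutator with any \<open>w\<close> is one of the generators of \<open>N\<close>;
      hence the image of \<open>?z\<close> is central in the quotient.\<close>
    have comm: "(N #> ?z) \<otimes>\<^bsub>G Mod N\<^esub> (N #> w) = (N #> w) \<otimes>\<^bsub>G Mod N\<^esub> (N #> ?z)"
      if w: "w \<in> carrier G" for w
    proof -
      have "?z \<otimes> w \<otimes> inv ?z \<otimes> inv w \<in> N"
        unfolding N_def lower_central_series.simps using Suc.IH w by (intro generate.incl) blast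
      then have "N #> (?z \<otimes> w \<otimes> inv ?z \<otimes> inv w) = \<one>\<^bsub>G Mod N\<^esub>"
        using N.rcos_const by (simp add: FactGroup_def)
      moreover have "?z \<otimes> w = (?z \<otimes> w \<otimes> inv ?z \<otimes> inv w) \<otimes> (w \<otimes> ?z)"
      proof -
        have "(a \<otimes> w \<otimes> inv a \<otimes> inv w) \<otimes> (w \<otimes> a) = a \<otimes> w" if "a \<in> carrier G" for a
        proof -
          have "inv w \<otimes> (w \<otimes> a) = a"
            using that w by (simp flip: m_assoc)
          then show ?thesis
            using that w by (simp add: m_assoc)
        qed
        from this[OF zG] show ?thesis
          by (rule sym)
      qed
      ultimately have "N #> (?z \<otimes> w) = N #> (w \<otimes> ?z)"
        using zG w hom.hom_mult[of "?z \<otimes> w \<otimes> inv ?z \<otimes> inv w" "w \<otimes> ?z"]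
        by (metis Q.l_one hom.hom_closed inv_closed m_closed)
      then show ?thesis
        using hom.hom_mult zG w by metis
    qed
    have "N #> ?z = \<one>\<^bsub>G Mod N\<^esub>"
    proof (rule Q.central_commutator_eq_one[of "N #> x" "N #> y" _ m n])
      show "N #> ?z = (N #> x) \<otimes>\<^bsub>G Mod N\<^esub> (N #> y) \<otimes>\<^bsub>G Mod N\<^esub> inv\<^bsub>G Mod N\<^esub> (N #> x)
          \<otimes>\<^bsub>G Mod N\<^esub> inv\<^bsub>G Mod N\<^esub> (N #> y)"
        using xy by (metis hom.hom_inv hom.hom_mult inv_closed m_closed)
      show "(N #> x) [^]\<^bsub>G Mod N\<^esub> m = \<one>\<^bsub>G Mod N\<^esub>" "(N #> y) [^]\<^bsub>G Mod N\<^esub> n = \<one>\<^bsub>G Mod N\<^esub>"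
        using xy pows by (metis hom.hom_nat_pow hom.hom_one)+
    qed (use comm xy pows hom.hom_closed in auto)
    then have "N #> ?z = N"
      by (simp add: FactGroup_def)
    then show ?case
      using rcos_self[OF zG N.subgroup_axioms] unfolding N_def by simp
  qed
  moreover obtain i where "lower_central_series G i = {\<one>}"
    using nil by (auto simp: nilpotent_group_def)
  ultimately have "?z = \<one>"
    by blast
  then show ?thesis
    using xy by (metis inv_equality inv_inv inv_closed inv_mult_group m_assoc m_closed)
qed

section \<open>Cyclic subgroups\<close>

abbreviation cyc :: "'a \<Rightarrow> 'a set" where
  "cyc x \<equiv> generate G {x}"

lemma mem_cyc_iff: "y \<in> carrier G \<Longrightarrow> x \<in> cyc y \<longleftrightarrow> (\<exists>k :: int. x = y [^] k)"
  by (auto simp: generate_pow)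

lemma cyc_subset: "x \<in> carrier G \<Longrightarrow> cyc x \<subseteq> carrier G"
  by (simp add: generate_incl)

lemma cyc_self: "x \<in> cyc x"
  by (simp add: generate.incl)

lemma cyc_mult: "y \<in> cyc x \<Longrightarrow> z \<in> cyc x \<Longrightarrow> y \<otimes> z \<in> cyc x"
  by (rule generate.eng)

lemma cyc_trans: "x \<in> cyc y \<Longrightarrow> y \<in> cyc z \<Longrightarrow> z \<in> carrier G \<Longrightarrow> x \<in> cyc z"
  using generate_subgroup_incl[of "{y}" "cyc z"] generate_is_subgroup[of "{z}"] by auto

lemma cyc_int_pow: "x \<in> cyc y \<Longrightarrow> y \<in> carrier G \<Longrightarrow> x [^] (k :: int) \<in> cyc y"
  using subgroup_int_pow_closed[OF generate_is_subgroup[of "{y}"]] by auto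

text \<open>Passing to p-parts is raising to a fixed power, so this is the monotonicity of that
  projection.\<close>

lemma cyc_int_pow_mono:
  assumes "x \<in> cyc y" "y \<in> carrier G"
  shows "x [^] (k :: int) \<in> cyc (y [^] k)"
  using assms by (auto simp: mem_cyc_iff int_pow_pow mult.commute)

lemma ord_dvd_if_mem_cyc:
  assumes "x \<in> cyc y" "y \<in> carrier G"
  shows "ord x dvd ord y"
proof -
  obtain k :: int where "x = y [^] k"
    using assms by (auto simp: mem_cyc_iff)
  then have "x [^] int (ord y) = \<one>"
    using assms(2) by (simp add: int_pow_pow int_pow_eq_id)
  then show ?thesis
    using assms(2) \<open>x = y [^] k\<close> by (simp add: int_pow_eq_id)
qed

text \<open>By Bezout, the multiples of \<open>i\<close> modulo \<open>n\<close> are exactly the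
  multiples of \<open>gcd i n\<close>. Only \<open>h [^] n = \<one>\<close> is assumed, so
  \<open>n\<close> may be any multiple of the order.\<close>

lemma int_pow_mem_cyc:
  assumes "h \<in> carrier G" "h [^] (n :: nat) = \<one>" "gcd i (int n) dvd j"
  shows "h [^] (j :: int) \<in> cyc (h [^] i)"
proof -
  obtain u v where uv: "u * i + v * int n = gcd i (int n)"
    using bezout_int by blast
  obtain c where "j = gcd i (int n) * c"
    using assms(3) by (auto elim: dvdE)
  then have "j = i * (u * c) + int n * (v * c)"
    using uv by (simp add: algebra_simps flip: uv)
  then have "h [^] j = (h [^] i) [^] (u * c) \<otimes> (h [^] int n) [^] (v * c)"
    using assms(1) by (simp add: int_pow_mult int_pow_pow)
  then have "h [^] j = (h [^] i) [^] (u * c)"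
    using assms(1,2) by (simp add: int_pow_int)
  then show ?thesis
    using assms(1) by (auto simp: mem_cyc_iff)
qed

text \<open>Up to generators, a power of \<open>h\<close> is determined by the gcd of its exponent
  with \<open>p ^ n\<close>. These gcds are powers of \<open>p\<close>, and of two powers of
  \<open>p\<close> one divides the other.\<close>

lemma cyc_chain_primepow:
  assumes p: "prime (p :: nat)" and h: "h \<in> carrier G" "h [^] (p ^ n) = \<one>"
    and x: "x \<in> cyc h" and y: "y \<in> cyc h"
  shows "x \<in> cyc y \<or> y \<in> cyc x"
proof -
  obtain i j :: int where ij: "x = h [^] i" "y = h [^] j"
    using x y h(1) by (auto simp: mem_cyc_iff)
  have "\<exists>a. gcd k (int (p ^ n)) = int p ^ a" for k :: int
  proof -
    have "gcd (nat \<bar>k\<bar>) (p ^ n) dvd p ^ n"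
      by (rule gcd_dvd2)
    then obtain a where "gcd (nat \<bar>k\<bar>) (p ^ n) = p ^ a"
      using p divides_primepow_nat by blast
    moreover have "gcd k (int (p ^ n)) = int (gcd (nat \<bar>k\<bar>) (p ^ n))"
      unfolding gcd_int_def by simp
    ultimately have "gcd k (int (p ^ n)) = int p ^ a"
      by simp
    then show ?thesis ..
  qed
  from this[of i] this[of j] obtain a b
    where ab: "gcd i (int (p ^ n)) = int p ^ a" "gcd j (int (p ^ n)) = int p ^ b"
    by blast
  have "int p ^ a dvd i" "int p ^ b dvd j"
    using gcd_dvd1[of i "int (p ^ n)"] gcd_dvd1[of j "int (p ^ n)"] unfolding ab .
  then have "gcd i (int (p ^ n)) dvd j \<or> gcd j (int (p ^ n)) dvd i"
    unfolding ab by (metis dvd_trans le_imp_power_dvd nat_le_linear)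
  then show ?thesis
    using int_pow_mem_cyc[OF h] ij by blast
qed

text \<open>With \<open>u * m + v * n = 1\<close>, the exponent \<open>n * v\<close> is 1 modulo
  \<open>m\<close> and 0 modulo \<open>n\<close>, so that power of \<open>x \<otimes> y\<close> is
  \<open>x\<close>; the other factor follows by symmetry.\<close>

lemma coprime_factors_mem_cyc:
  assumes xy: "x \<in> carrier G" "y \<in> carrier G" "x \<otimes> y = y \<otimes> x"
    and pows: "x [^] (m :: nat) = \<one>" "y [^] (n :: nat) = \<one>" "coprime m n"
  shows "x \<in> cyc (x \<otimes> y)" "y \<in> cyc (x \<otimes> y)"
proof -
  have *: "a \<in> cyc (a \<otimes> b)" if "a \<in> carrier G" "b \<in> carrier G" "a \<otimes> b = b \<otimes> a"
    "a [^] m' = \<one>" "b [^] n' = \<one>" and cop: "coprime m' n'" for a b and m' n' :: nat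
  proof -
    obtain u v where uv: "u * int m' + v * int n' = 1"
      using bezout_int[of "int m'" "int n'"] cop by auto
    have "(a \<otimes> b) [^] (int n' * v) = a [^] (int n' * v) \<otimes> (b [^] int n') [^] v"
      using that int_pow_mult_distrib[OF that(3,1,2)] by (simp add: int_pow_pow)
    also have "\<dots> = (a [^] int m') [^] u \<otimes> a [^] (int n' * v)"
      using that by (simp add: int_pow_int)
    also have "\<dots> = a [^] (int m' * u + int n' * v)"
      using that by (simp add: int_pow_pow int_pow_mult)
    also have "int m' * u + int n' * v = 1"
      using uv by (simp add: mult.commute)
    finally show ?thesis
      using that by (metis int_pow_1 m_closed mem_cyc_iff)
  qed
  show "x \<in> cyc (x \<otimes> y)"
    using * assms by blast
  show "y \<in> cyc (x \<otimes> y)"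
    using *[of y x n m] assms by (simp add: coprime_commute)
qed

text \<open>The overgroup generated by \<open>g\<close> may be larger than the group generated by
  \<open>x\<close> and \<open>y\<close>. If \<open>x = g [^] i\<close> and
  \<open>y = g [^] j\<close>, the latter is generated by \<open>g [^] gcd i j\<close>, again by
  Bezout.\<close>

lemma subgroup_generated_pair_cyclic_iff:
  assumes "x \<in> carrier G" "y \<in> carrier G"
  shows "cyclic_group (subgroup_generated G {x, y}) \<longleftrightarrow> (\<exists>g \<in> carrier G. x \<in> cyc g \<and> y \<in> cyc g)"
proof
  let ?S = "subgroup_generated G {x, y}"
  interpret S: group ?S
    by (rule group_subgroup_generated)
  have car: "carrier ?S = generate G {x, y}"
    using assms by (simp add: carrier_subgroup_generated Int_absorb1)
  assume "cyclic_group ?S"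
  then obtain g where g: "g \<in> carrier ?S" "carrier ?S = range (\<lambda>n :: int. g [^]\<^bsub>?S\<^esub> n)"
    using S.cyclic_group by auto
  have gG: "g \<in> carrier G"
    using g(1) assms generate_in_carrier[of "{x, y}" g] unfolding car by simp
  have "carrier ?S = range (\<lambda>n :: int. g [^] n)"
    using g(2) int_pow_subgroup_generated[OF g(1)] by simp
  then have "carrier ?S = cyc g"
    using gG by (auto simp: generate_pow)
  then show "\<exists>g \<in> carrier G. x \<in> cyc g \<and> y \<in> cyc g"
    using gG car by (auto intro: generate.incl)
next
  assume "\<exists>g \<in> carrier G. x \<in> cyc g \<and> y \<in> cyc g"
  then obtain g and i j :: int where g: "g \<in> carrier G" "x = g [^] i" "y = g [^] j"
    by (auto simp: mem_cyc_iff)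
  let ?z = "g [^] gcd i j"
  obtain u v where uv: "u * i + v * j = gcd i j"
    using bezout_int by blast
  have sub: "subgroup (generate G {x, y}) G"
    using assms by (intro generate_is_subgroup) auto
  have "?z = x [^] u \<otimes> y [^] v"
    using g(1) by (simp add: g int_pow_pow int_pow_mult mult.commute flip: uv)
  moreover have "x [^] u \<in> generate G {x, y}" "y [^] v \<in> generate G {x, y}"
    using sub by (auto intro: subgroup_int_pow_closed generate.incl)
  ultimately have "?z \<in> generate G {x, y}"
    by (simp add: generate.eng)
  then have "cyc ?z \<subseteq> generate G {x, y}"
    using sub by (intro generate_subgroup_incl) auto
  moreover have "x \<in> cyc ?z" "y \<in> cyc ?z"
  proof -
    have "g [^] k \<in> cyc ?z" if "gcd i j dvd k" for k
      using that g(1) by (auto simp: mem_cyc_iff int_pow_pow elim!: dvdE)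
    then show "x \<in> cyc ?z" "y \<in> cyc ?z"
      using g(2,3) by auto
  qed
  then have "generate G {x, y} \<subseteq> cyc ?z"
    using g(1) by (intro generate_subgroup_incl generate_is_subgroup) auto
  ultimately have "subgroup_generated G {x, y} = subgroup_generated G {?z}"
    using assms g(1) by (simp add: subgroup_generated_def Int_absorb1)
  then show "cyclic_group (subgroup_generated G {x, y})"
    using cyclic_group_generated by metis
qed

lemma difference_graph_adj_iff:
  "(x, y) \<in> parcs (difference_graph G) \<longleftrightarrow>
     x \<in> carrier G \<and> y \<in> carrier G \<and> (\<exists>g \<in> carrier G. x \<in> cyc g \<and> y \<in> cyc g) \<and>
     x \<notin> cyc y \<and> y \<notin> cyc x"
  using subgroup_generated_pair_cyclic_iff by (auto simp: difference_graph_adj)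

lemma pverts_difference_graph:
  "pverts (difference_graph G) = {x \<in> carrier G. \<exists>y. (x, y) \<in> parcs (difference_graph G)}"
proof -
  have "(x, y) \<in> parcs (difference_graph G) \<longleftrightarrow> (y, x) \<in> parcs (difference_graph G)" for x y
    by (auto simp: difference_graph_adj_iff)
  then show ?thesis
    by (auto simp: difference_graph_def remove_isolated_def edge_difference_def
        enhanced_power_graph_def)
qed

section \<open>Sylow subgroups\<close>

lemma pow_card_subgroup:
  assumes "subgroup P G" "x \<in> P"
  shows "x [^] card P = \<one>"
  using group.pow_order_eq_1[OF subgroup_imp_group[OF assms(1)], of x] assms(2)
  by (simp add: order_def flip: nat_pow_consistent)

lemma sylow_subgroup_exists:
  assumes "finite (carrier G)" "prime p"
  shows "\<exists>P. sylow_subgroup p P G"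
proof -
  have "order G = p ^ multiplicity p (order G) * (order G div p ^ multiplicity p (order G))"
    by (simp add: multiplicity_dvd)
  then show ?thesis
    using sylow_thm[OF assms(2) is_group _ assms(1)] by (auto simp: sylow_subgroup_def)
qed

lemma cyclic_subgroup_iff:
  assumes "subgroup P G"
  shows "cyclic_group (G\<lparr>carrier := P\<rparr>) \<longleftrightarrow> (\<exists>h \<in> P. P = cyc h)"
proof -
  interpret P: group "G\<lparr>carrier := P\<rparr>"
    using assms by (rule subgroup_imp_group)
  have "range (\<lambda>n :: int. h [^]\<^bsub>G\<lparr>carrier := P\<rparr>\<^esub> n) = cyc h" if "h \<in> P" for h
    using that assms subgroup.mem_carrier[OF assms that]
    by (auto simp: generate_pow simp flip: int_pow_consistent)
  then show ?thesis
    using P.cyclic_group by auto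
qed

lemma order_factorization:
  assumes "finite (carrier G)" "prime p"
  obtains m where "order G = p ^ multiplicity p (order G) * m" "coprime (p ^ multiplicity p (order G)) m"
proof -
  have "order G \<noteq> 0" "\<not> is_unit p"
    using assms order_gt_0_iff_finite by (auto simp: prime_nat_iff)
  then obtain m where "order G = p ^ multiplicity p (order G) * m" "\<not> p dvd m"
    using multiplicity_decompose'[of "order G" p] by metis
  then show thesis
    using that assms(2) by (meson coprime_power_left_iff prime_imp_coprime)
qed

text \<open>Source of the vertices c and d of the 5-cycle: a Sylow subgroup for a prime divisor of
  the order has a non-identity element.\<close>

lemma nontrivial_primepow_element:
  assumes "finite (carrier G)" "prime p" "p dvd order G"
  shows "\<exists>c \<in> carrier G. c \<noteq> \<one> \<and> (\<exists>k. c [^] (p ^ k) = \<one>)"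
proof -
  obtain P where P: "subgroup P G" "card P = p ^ multiplicity p (order G)"
    using sylow_subgroup_exists[OF assms(1,2)] by (auto simp: sylow_subgroup_def)
  have "order G \<noteq> 0"
    using assms(1) order_gt_0_iff_finite by auto
  then have "multiplicity p (order G) \<noteq> 0"
    using assms(2,3) by (simp add: prime_multiplicity_gt_zero_iff prime_imp_prime_elem)
  then have "card P \<noteq> 1"
    using P(2) assms(2) by (auto simp: prime_nat_iff)
  then have "P \<noteq> {\<one>}"
    by auto
  then obtain c where "c \<in> P" "c \<noteq> \<one>"
    using subgroup.one_closed[OF P(1)] by blast
  then show ?thesis
    using pow_card_subgroup[OF P(1)] P(2) subgroup.mem_carrier[OF P(1)] by metis
qed

lemma eq_one_if_mem_cyc_coprime:
  assumes "x \<in> cyc y" "y \<in> carrier G" "x [^] (m :: nat) = \<one>" "y [^] (n :: nat) = \<one>" "coprime m n"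
  shows "x = \<one>"
proof -
  have "x \<in> carrier G"
    using assms(1,2) cyc_subset by blast
  moreover have "x [^] n = \<one>"
    using ord_dvd_if_mem_cyc[OF assms(1,2)] assms(2,4) \<open>x \<in> carrier G\<close> dvd_trans
    by (metis pow_eq_id)
  ultimately show ?thesis
    using eq_one_if_coprime_pows assms(3,5) by blast
qed

text \<open>Raising to the power \<open>m * t\<close> projects every element to its \<open>p\<close>-part, which moves \<open>x\<close> and \<open>y\<close>
  into a cyclic group of prime power order.\<close>

lemma primepow_elements_in_cyc_comparable:
  assumes fin: "finite (carrier G)" and p: "prime p"
    and P: "x [^] (p ^ multiplicity p (order G)) = \<one>" "y [^] (p ^ multiplicity p (order G)) = \<one>"
    and g: "g \<in> carrier G" "x \<in> cyc g" "y \<in> cyc g"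
  shows "x \<in> cyc y \<or> y \<in> cyc x"
proof -
  define q where "q = p ^ multiplicity p (order G)"
  obtain m where m: "order G = q * m" "coprime q m"
    using order_factorization[OF fin p] unfolding q_def by blast
  obtain s t where st: "s * int q + t * int m = 1"
    using bezout_int[of "int q" "int m"] m(2) by auto
  let ?h = "g [^] (int m * t)"
  have "?h [^] q = (g [^] int (order G)) [^] t"
    using g(1) by (simp add: m(1) int_pow_pow mult_ac flip: int_pow_int)
  then have h: "?h \<in> carrier G" "?h [^] q = \<one>"
    using g(1) pow_order_eq_1 by (simp_all add: int_pow_int)
  \<comment> \<open>Since \<open>z [^] q = \<one>\<close> and \<open>m * t\<close> is 1 modulo
    \<open>q\<close>, the projection fixes \<open>z\<close>; being monotone, it carries
    \<open>z \<in> cyc g\<close> to \<open>z \<in> cyc ?h\<close>.\<close>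
  have "z \<in> cyc ?h" if "z \<in> cyc g" "z [^] q = \<one>" for z
  proof -
    have zG: "z \<in> carrier G"
      using that g(1) cyc_subset by blast
    have "z = z [^] (int q * s + int m * t)"
      using st zG by (simp add: mult.commute)
    also have "\<dots> = (z [^] int q) [^] s \<otimes> z [^] (int m * t)"
      using zG by (simp only: int_pow_mult int_pow_pow)
    also have "\<dots> = z [^] (int m * t)"
      using zG that(2) by (simp only: int_pow_int int_pow_one l_one int_pow_closed)
    finally show ?thesis
      using cyc_int_pow_mono[OF that(1) g(1), of "int m * t"] by metis
  qed
  then show ?thesis
    using cyc_chain_primepow[OF p h[unfolded q_def]] P g unfolding q_def by blast
qed

section \<open>Two prime divisors\<close>

lemma comparability_difference_graph:
  assumes nil: "nilpotent_group G" and pq: "prime p" "prime q" "p \<noteq> q"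
    and ord: "order G = p ^ i * q ^ j"
  shows "comparability_graph (with_proj (difference_graph G))"
proof -
  let ?m = "p ^ i" and ?n = "q ^ j"
  have cop: "coprime ?m ?n"
    using pq by (simp add: primes_coprime)
  then obtain s t where st: "s * int ?m + t * int ?n = 1"
    using bezout_int[of "int ?m" "int ?n"] by auto
  \<comment> \<open>\<open>u\<close> is 1 modulo \<open>?m\<close> and 0 modulo \<open>?n\<close>,
    and \<open>v\<close> the other way round. So \<open>x [^] u\<close> is the p-part of
    \<open>x\<close>, \<open>x [^] v\<close> its q-part, and \<open>x\<close> is their
    product.\<close>
  define u v where "u = int ?n * t" and "v = int ?m * s"
  have uv: "u + v = 1"
    using st by (simp add: u_def v_def mult.commute)
  have pow_u: "(x [^] u) [^] ?m = \<one>" and pow_v: "(x [^] v) [^] ?n = \<one>" if "x \<in> carrier G" for x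
  proof -
    have "(x [^] u) [^] ?m = (x [^] int (order G)) [^] t"
      using that by (simp add: ord u_def int_pow_pow mult_ac flip: int_pow_int)
    moreover have "(x [^] v) [^] ?n = (x [^] int (order G)) [^] s"
      using that by (simp add: ord v_def int_pow_pow mult_ac flip: int_pow_int)
    moreover have "x [^] int (order G) = \<one>"
      using that pow_order_eq_1 by (simp add: int_pow_int)
    ultimately show "(x [^] u) [^] ?m = \<one>" "(x [^] v) [^] ?n = \<one>"
      by simp_all
  qed
  have split: "x [^] u \<otimes> x [^] v = x" if "x \<in> carrier G" for x
    using that uv by (simp flip: int_pow_mult)
  have memI: "x \<in> cyc g" if "x [^] u \<in> cyc g" "x [^] v \<in> cyc g" "x \<in> carrier G" for x g
    using cyc_mult[OF that(1,2)] split[OF that(3)] by simp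
  have mem_iff: "x \<in> cyc y \<longleftrightarrow> x [^] u \<in> cyc (y [^] u) \<and> x [^] v \<in> cyc (y [^] v)"
    if "x \<in> carrier G" "y \<in> carrier G" for x y
  proof
    assume "x \<in> cyc y"
    then show "x [^] u \<in> cyc (y [^] u) \<and> x [^] v \<in> cyc (y [^] v)"
      using cyc_int_pow_mono that(2) by blast
  next
    assume "x [^] u \<in> cyc (y [^] u) \<and> x [^] v \<in> cyc (y [^] v)"
    then have "x [^] u \<in> cyc y" "x [^] v \<in> cyc y"
      using cyc_trans cyc_int_pow[OF cyc_self that(2)] that(2) by blast+
    then show "x \<in> cyc y"
      using memI that(1) by blast
  qed
  \<comment> \<open>From \<open>x\<close> to \<open>y\<close> the p-part strictly rises and the
    q-part strictly falls. Each of the two strict comparisons is transitive on its own.\<close>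
  define r where "r = {(x, y). x \<in> carrier G \<and> y \<in> carrier G \<and>
    x [^] u \<in> cyc (y [^] u) \<and> y [^] u \<notin> cyc (x [^] u) \<and>
    y [^] v \<in> cyc (x [^] v) \<and> x [^] v \<notin> cyc (y [^] v)}"
  have adj: "(x, y) \<in> parcs (difference_graph G) \<longleftrightarrow> (x, y) \<in> r \<or> (y, x) \<in> r" for x y
  proof
    assume "(x, y) \<in> parcs (difference_graph G)"
    then obtain g where xy: "x \<in> carrier G" "y \<in> carrier G" "x \<notin> cyc y" "y \<notin> cyc x"
      and g: "g \<in> carrier G" "x \<in> cyc g" "y \<in> cyc g"
      by (auto simp: difference_graph_adj_iff)
    have "x [^] u \<in> cyc (y [^] u) \<or> y [^] u \<in> cyc (x [^] u)"
      using pq(1) pow_u[OF g(1)] g by (intro cyc_chain_primepow[of p "g [^] u"] cyc_int_pow_mono) auto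
    moreover have "x [^] v \<in> cyc (y [^] v) \<or> y [^] v \<in> cyc (x [^] v)"
      using pq(2) pow_v[OF g(1)] g by (intro cyc_chain_primepow[of q "g [^] v"] cyc_int_pow_mono) auto
    ultimately show "(x, y) \<in> r \<or> (y, x) \<in> r"
      using xy mem_iff[OF xy(1,2)] mem_iff[OF xy(2,1)] by (auto simp: r_def)
  next
    have arc: "(x, y) \<in> parcs (difference_graph G)" if "(x, y) \<in> r" for x y
    proof -
      have xy: "x \<in> carrier G" "y \<in> carrier G"
        and u: "x [^] u \<in> cyc (y [^] u)" "y [^] u \<notin> cyc (x [^] u)"
        and v: "y [^] v \<in> cyc (x [^] v)" "x [^] v \<notin> cyc (y [^] v)"
        using that by (auto simp: r_def)
      \<comment> \<open>The larger p-part, that of \<open>y\<close>, times the larger q-part, that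
        of \<open>x\<close>. The factors commute and have coprime orders, so the cyclic group of the
        product contains both, and with them \<open>x\<close> and \<open>y\<close>.\<close>
      let ?g = "y [^] u \<otimes> x [^] v"
      have gG: "?g \<in> carrier G"
        using xy by simp
      have comm: "y [^] u \<otimes> x [^] v = x [^] v \<otimes> y [^] u"
        using xy pow_u pow_v by (intro nilpotent_coprime_commute[OF nil _ _ _ _ cop]) auto
      have factors: "y [^] u \<in> cyc ?g" "x [^] v \<in> cyc ?g"
        using coprime_factors_mem_cyc[OF _ _ comm pow_u pow_v cop] xy by auto
      then have "x \<in> cyc ?g" "y \<in> cyc ?g"
        using memI cyc_trans[OF u(1) _ gG] cyc_trans[OF v(1) _ gG] xy by blast+
      then show ?thesis
        unfolding difference_graph_adj_iff using xy gG u v mem_iff by blast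
    qed
    assume "(x, y) \<in> r \<or> (y, x) \<in> r"
    then show "(x, y) \<in> parcs (difference_graph G)"
    proof
      assume "(y, x) \<in> r"
      from arc[OF this] show ?thesis
        by (auto simp: difference_graph_adj_iff)
    qed (rule arc)
  qed
  have "r \<subseteq> pverts (difference_graph G) \<times> pverts (difference_graph G)"
    using adj unfolding pverts_difference_graph by (auto simp: r_def)
  moreover have "irrefl r"
    by (auto simp: irrefl_def r_def cyc_self)
  moreover have "trans r"
  proof (rule transI)
    fix x y z
    assume "(x, y) \<in> r" "(y, z) \<in> r"
    then have carrier: "x \<in> carrier G" "y \<in> carrier G" "z \<in> carrier G"
      and u: "x [^] u \<in> cyc (y [^] u)" "y [^] u \<in> cyc (z [^] u)" "y [^] u \<notin> cyc (x [^] u)"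
      and v: "z [^] v \<in> cyc (y [^] v)" "y [^] v \<in> cyc (x [^] v)" "x [^] v \<notin> cyc (y [^] v)"
      by (auto simp: r_def)
    have "x [^] u \<in> cyc (z [^] u)" "z [^] v \<in> cyc (x [^] v)"
      using cyc_trans[OF u(1,2)] cyc_trans[OF v(1,2)] carrier by simp_all
    moreover have "z [^] u \<notin> cyc (x [^] u)" "x [^] v \<notin> cyc (z [^] v)"
      using cyc_trans[OF u(2), of "x [^] u"] cyc_trans[OF _ v(1)] carrier u(3) v(3) by auto
    ultimately show "(x, z) \<in> r"
      using carrier by (simp add: r_def)
  qed
  moreover have "parcs (difference_graph G) = r \<union> r\<inverse>"
    using adj by auto
  ultimately show ?thesis
    unfolding comparability_graph_def with_proj_simps by blast
qed

section \<open>A non-cyclic Sylow subgroup\<close>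

text \<open>If all pairs were comparable, an element \<open>a\<close> of maximal order would
  generate \<open>P\<close>: for each \<open>b\<close> either \<open>b \<in> cyc a\<close>, or
  \<open>a \<in> cyc b\<close> and maximality forces \<open>cyc a = cyc b\<close>.\<close>

lemma incomparable_pair_if_not_cyclic:
  assumes fin: "finite (carrier G)" and P: "subgroup P G" "\<not> cyclic_group (G\<lparr>carrier := P\<rparr>)"
  shows "\<exists>a \<in> P. \<exists>b \<in> P. a \<notin> cyc b \<and> b \<notin> cyc a"
proof (rule ccontr)
  assume "\<not> ?thesis"
  then have chain: "a \<in> cyc b \<or> b \<in> cyc a" if "a \<in> P" "b \<in> P" for a b
    using that by blast
  have PG: "P \<subseteq> carrier G" and "finite P"
    using P(1) fin subgroup.subset finite_subset by blast+
  moreover have "P \<noteq> {}"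
    using P(1) subgroup.one_closed by blast
  ultimately obtain a where a: "a \<in> P" "\<forall>b \<in> P. ord b \<le> ord a"
    using Max_in[of "ord ` P"] Max_ge[of "ord ` P"] by fastforce
  have "b \<in> cyc a" if "b \<in> P" for b
  proof (cases "a \<in> cyc b")
    case True
    have bG: "b \<in> carrier G" and aG: "a \<in> carrier G"
      using a that PG by auto
    have "cyc a \<subseteq> cyc b"
      using True bG by (intro generate_subgroup_incl generate_is_subgroup) auto
    moreover have "card (cyc b) \<le> card (cyc a)"
      using a(2) that generate_pow_card[OF aG] generate_pow_card[OF bG] by metis
    moreover have "finite (cyc b)"
      using cyc_subset[OF bG] fin finite_subset by blast
    ultimately have "cyc a = cyc b"
      by (simp add: card_seteq)
    then show ?thesis
      using cyc_self by simp
  next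
    case False
    then show ?thesis
      using chain a that by blast
  qed
  moreover have "cyc a \<subseteq> P"
    using a P(1) by (intro generate_subgroup_incl) auto
  ultimately have "P = cyc a"
    by blast
  then have "cyclic_group (G\<lparr>carrier := P\<rparr>)"
    unfolding cyclic_subgroup_iff[OF P(1)] using a(1) by (intro bexI[of _ a])
  then show False
    using P(2) by contradiction
qed

lemma not_perfect_difference_graph:
  assumes nil: "nilpotent_group G" and fin: "finite (carrier G)"
    and primes: "prime p" "prime q" "prime r" "p \<noteq> q" "p \<noteq> r" "q \<noteq> r"
    and dvd: "q dvd order G" "r dvd order G"
    and P: "sylow_subgroup p P G" "\<not> cyclic_group (G\<lparr>carrier := P\<rparr>)"
  shows "\<not> perfect_graph (with_proj (difference_graph G))"
proof -
  interpret D: pair_graph "difference_graph G"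
    using fin by (rule pair_graph_difference_graph)
  let ?i = "p ^ multiplicity p (order G)"
  have sub: "subgroup P G" and card: "card P = ?i"
    using P(1) by (auto simp: sylow_subgroup_def)
  obtain a b where ab: "a \<in> P" "b \<in> P" "a \<notin> cyc b" "b \<notin> cyc a"
    using incomparable_pair_if_not_cyclic[OF fin sub P(2)] by blast
  have aG: "a \<in> carrier G" "a [^] ?i = \<one>" and bG: "b \<in> carrier G" "b [^] ?i = \<one>"
    using ab subgroup.mem_carrier[OF sub] pow_card_subgroup[OF sub] card by auto
  \<comment> \<open>Elements of p-power order inside one cyclic group are comparable, which
    \<open>a\<close> and \<open>b\<close> are not.\<close>
  have no_common: "\<not> (a \<in> cyc g \<and> b \<in> cyc g)" if "g \<in> carrier G" for g
    using primepow_elements_in_cyc_comparable[OF fin primes(1) aG(2) bG(2) that] ab by blast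
  have ne: "a \<noteq> \<one>" "b \<noteq> \<one>"
    using ab generate.one by metis+
  obtain c j where c: "c \<in> carrier G" "c \<noteq> \<one>" "c [^] (q ^ j) = \<one>"
    using nontrivial_primepow_element[OF fin primes(2) dvd(1)] by blast
  obtain d k where d: "d \<in> carrier G" "d \<noteq> \<one>" "d [^] (r ^ k) = \<one>"
    using nontrivial_primepow_element[OF fin primes(3) dvd(2)] by blast
  have cop: "coprime ?i (q ^ j)" "coprime ?i (r ^ k)" "coprime (q ^ j) (r ^ k)"
    using primes by (simp_all add: primes_coprime)

  have arc_sym: "(y, x) \<in> parcs (difference_graph G)" if "(x, y) \<in> parcs (difference_graph G)" for x y
    using that by (auto simp: difference_graph_adj_iff)
  have coprime_arc: "(x, y) \<in> parcs (difference_graph G)"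
    if "x \<in> carrier G" "y \<in> carrier G" "x [^] m = \<one>" "y [^] n = \<one>" "coprime m n" "x \<noteq> \<one>" "y \<noteq> \<one>"
    for x y and m n :: nat
  proof -
    have "x \<otimes> y = y \<otimes> x"
      using nilpotent_coprime_commute[OF nil] that by blast
    then have "x \<in> cyc (x \<otimes> y)" "y \<in> cyc (x \<otimes> y)"
      using coprime_factors_mem_cyc that by blast+
    moreover have "x \<notin> cyc y" "y \<notin> cyc x"
      using eq_one_if_mem_cyc_coprime that by (metis coprime_commute)+
    ultimately show ?thesis
      using that by (auto simp: difference_graph_adj_iff)
  qed
  \<comment> \<open>The two kinds of edges at a product, for pairwise coprime orders. A common
    cyclic overgroup of \<open>x \<otimes> y\<close> and \<open>z\<close> contains \<open>y\<close>,
    hence also \<open>y \<otimes> z\<close>; containments fail because \<open>x\<close> survives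
    only on one side and \<open>z\<close> only on the other.\<close>
  have arcs: "(x \<otimes> y, z) \<in> parcs (difference_graph G)" "(x \<otimes> y, y \<otimes> z) \<in> parcs (difference_graph G)"
    if x: "x \<in> carrier G" "x [^] l = \<one>" "x \<noteq> \<one>" and y: "y \<in> carrier G" "y [^] m = \<one>"
      and z: "z \<in> carrier G" "z [^] n = \<one>" "z \<noteq> \<one>"
      and co: "coprime l m" "coprime l n" "coprime m n"
    for x y z and l m n :: nat
  proof -
    have xy: "x \<otimes> y = y \<otimes> x" and yz: "y \<otimes> z = z \<otimes> y"
      using nilpotent_coprime_commute[OF nil] x y z co by blast+
    have xyG: "x \<otimes> y \<in> carrier G" and yzG: "y \<otimes> z \<in> carrier G"
      using x y z by auto
    have pow: "a [^] (m * n) = \<one>" if "a \<in> carrier G" "a [^] m = \<one>" for a and m n :: nat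
      using that by (simp flip: nat_pow_pow)
    have xy_pow: "(x \<otimes> y) [^] (l * m) = \<one>"
      using pow_mult_distrib[OF xy x(1) y(1)] pow[OF x(1,2), of m] pow[OF y(1,2), of l]
      by (simp add: mult.commute)
    have yz_pow: "(y \<otimes> z) [^] (m * n) = \<one>"
      using pow_mult_distrib[OF yz y(1) z(1)] pow[OF y(1,2), of n] pow[OF z(1,2), of m]
      by (simp add: mult.commute)
    have mem_xy: "x \<in> cyc (x \<otimes> y)" "y \<in> cyc (x \<otimes> y)"
      using coprime_factors_mem_cyc[OF x(1) y(1) xy x(2) y(2) co(1)] .
    have mem_yz: "z \<in> cyc (y \<otimes> z)"
      using coprime_factors_mem_cyc[OF y(1) z(1) yz y(2) z(2) co(3)] by blast
    have co': "coprime (l * m) n" "coprime l (m * n)"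
      using co by simp_all
    have ne: "x \<otimes> y \<noteq> \<one>"
    proof
      assume "x \<otimes> y = \<one>"
      then have "x = \<one>"
        using mem_xy(1) by (simp add: generate_one)
      then show False
        using x(3) by simp
    qed
    show xy_z: "(x \<otimes> y, z) \<in> parcs (difference_graph G)"
      using coprime_arc[OF xyG z(1) xy_pow z(2) co'(1) ne z(3)] .
    then obtain g where g: "g \<in> carrier G" "x \<otimes> y \<in> cyc g" "z \<in> cyc g"
      by (auto simp: difference_graph_adj_iff)
    then have "y \<otimes> z \<in> cyc g"
      using mem_xy(2) by (intro cyc_mult) (auto intro: cyc_trans)
    moreover have "x \<otimes> y \<notin> cyc (y \<otimes> z)"
    proof
      assume "x \<otimes> y \<in> cyc (y \<otimes> z)"
      then have "x \<in> cyc (y \<otimes> z)"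
        using mem_xy(1) yzG cyc_trans by blast
      then show False
        using eq_one_if_mem_cyc_coprime[OF _ yzG x(2) yz_pow co'(2)] x(3) by blast
    qed
    moreover have "y \<otimes> z \<notin> cyc (x \<otimes> y)"
    proof
      assume "y \<otimes> z \<in> cyc (x \<otimes> y)"
      then have "z \<in> cyc (x \<otimes> y)"
        using mem_yz xyG cyc_trans by blast
      then show False
        using eq_one_if_mem_cyc_coprime[OF _ xyG z(2) xy_pow] co'(1) z(3) by (simp add: coprime_commute)
    qed
    ultimately show "(x \<otimes> y, y \<otimes> z) \<in> parcs (difference_graph G)"
      using g xyG yzG by (auto simp: difference_graph_adj_iff)
  qed

  have comm: "a \<otimes> c = c \<otimes> a" "b \<otimes> d = d \<otimes> b" "c \<otimes> d = d \<otimes> c"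
    using nilpotent_coprime_commute[OF nil] aG bG c d cop by blast+
  have cop': "coprime (r ^ k) (q ^ j)"
    using cop(3) by (simp add: coprime_commute)
  have cycle: "(a \<otimes> c, c \<otimes> d) \<in> parcs (difference_graph G)" "(c \<otimes> d, b \<otimes> d) \<in> parcs (difference_graph G)"
    "(b \<otimes> d, c) \<in> parcs (difference_graph G)" "(c, d) \<in> parcs (difference_graph G)"
    "(d, a \<otimes> c) \<in> parcs (difference_graph G)"
  proof -
    show "(a \<otimes> c, c \<otimes> d) \<in> parcs (difference_graph G)" "(d, a \<otimes> c) \<in> parcs (difference_graph G)"
      using arcs[OF aG ne(1) c(1,3) d(1,3,2) cop] arc_sym by blast+
    \<comment> \<open>The same two edges with \<open>c\<close> and \<open>d\<close> interchanged, as
      \<open>d \<otimes> c = c \<otimes> d\<close>.\<close>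
    show "(b \<otimes> d, c) \<in> parcs (difference_graph G)" "(c \<otimes> d, b \<otimes> d) \<in> parcs (difference_graph G)"
      using arcs[OF bG ne(2) d(1,3) c(1,3,2) cop(2,1) cop'] arc_sym comm(3) by simp_all
    show "(c, d) \<in> parcs (difference_graph G)"
      using coprime_arc[OF c(1) d(1) c(3) d(3) cop(3) c(2) d(2)] .
  qed
  have chord: "(x, y) \<notin> parcs (difference_graph G)" if "x \<in> cyc y \<or> y \<in> cyc x" for x y
    using that by (auto simp: difference_graph_adj_iff)
  have ac: "a \<in> cyc (a \<otimes> c)" "c \<in> cyc (a \<otimes> c)"
    using coprime_factors_mem_cyc[OF aG(1) c(1) comm(1) aG(2) c(3) cop(1)] .
  have bd: "b \<in> cyc (b \<otimes> d)" "d \<in> cyc (b \<otimes> d)"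
    using coprime_factors_mem_cyc[OF bG(1) d(1) comm(2) bG(2) d(3) cop(2)] .
  have cd: "c \<in> cyc (c \<otimes> d)" "d \<in> cyc (c \<otimes> d)"
    using coprime_factors_mem_cyc[OF c(1) d(1) comm(3) c(3) d(3) cop(3)] .
  have vert: "x \<in> pverts (difference_graph G)" if "(x, y) \<in> parcs (difference_graph G)" for x y
    using that D.wellformed(1)[of "(x, y)"] by simp
  \<comment> \<open>A common cyclic overgroup would contain the factors \<open>a\<close> and
    \<open>b\<close> as well.\<close>
  have "(a \<otimes> c, b \<otimes> d) \<notin> parcs (difference_graph G)"
    using no_common cyc_trans[OF ac(1)] cyc_trans[OF bd(1)] by (auto simp: difference_graph_adj_iff)
  moreover have "(a \<otimes> c, c) \<notin> parcs (difference_graph G)" "(c \<otimes> d, c) \<notin> parcs (difference_graph G)"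
    "(c \<otimes> d, d) \<notin> parcs (difference_graph G)" "(b \<otimes> d, d) \<notin> parcs (difference_graph G)"
    using chord ac bd cd by blast+
  moreover have "{a \<otimes> c, c \<otimes> d, b \<otimes> d, c, d} \<subseteq> pverts (difference_graph G)"
    using cycle vert by blast
  ultimately show ?thesis
    using cycle D.not_perfect_if_induced_C5[of "a \<otimes> c" "c \<otimes> d" "b \<otimes> d" c d] by simp
qed

section \<open>All Sylow subgroups cyclic\<close>

text \<open>An element \<open>g\<close> of maximal order generates: if the \<open>p\<close>-part of its order were too
  small, replacing the \<open>p\<close>-part of \<open>g\<close> by a generator of a Sylow subgroup would increase the order.\<close>

lemma nilpotent_cyclic_if_sylow_cyclic:
  assumes nil: "nilpotent_group G" and fin: "finite (carrier G)"
    and sylow: "\<And>p P. p \<in> prime_divisors G \<Longrightarrow> sylow_subgroup p P G \<Longrightarrow> cyclic_group (G\<lparr>carrier := P\<rparr>)"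
  shows "\<exists>g \<in> carrier G. carrier G = cyc g"
proof -
  obtain g where g: "g \<in> carrier G" "\<forall>x \<in> carrier G. ord x \<le> ord g"
    using Max_in[of "ord ` carrier G"] Max_ge[of "ord ` carrier G"] fin carrier_not_empty by fastforce
  have ord_pos: "ord x > 0" if "x \<in> carrier G" for x
    using ord_ge_1[OF fin that] by simp
  have ord0: "order G \<noteq> 0"
    using fin order_gt_0_iff_finite by auto
  have "order G dvd ord g"
  proof (rule multiplicity_le_imp_dvd[OF ord0])
    fix p :: nat
    assume p: "prime p"
    let ?A = "multiplicity p (order G)" and ?B = "multiplicity p (ord g)"
    show "?A \<le> ?B"
    proof (rule ccontr)
      assume less: "\<not> ?A \<le> ?B"
      then have "p dvd order G"
        using not_dvd_imp_multiplicity_0 by fastforce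
      then have "p \<in> prime_divisors G"
        using p by (simp add: prime_divisors_def)
      moreover obtain P where P: "sylow_subgroup p P G"
        using sylow_subgroup_exists[OF fin p] by blast
      ultimately obtain h where h: "h \<in> P" "P = cyc h"
        using sylow cyclic_subgroup_iff by (metis sylow_subgroup_def)
      have hG: "h \<in> carrier G"
        using h P subgroup.mem_carrier by (auto simp: sylow_subgroup_def)
      have ord_h: "ord h = p ^ ?A"
        using P h generate_pow_card[OF hG] by (simp add: sylow_subgroup_def)
      obtain m where m: "ord g = p ^ ?B * m" "\<not> p dvd m"
        using multiplicity_decompose'[of "ord g" p] ord_pos[OF g(1)] p
        by (metis less_numeral_extra(3) not_prime_unit)
      \<comment> \<open>The power strips the p-part from \<open>g\<close> and leaves an element of
        order \<open>m\<close>. The product with \<open>h\<close> has order divisible by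
        \<open>m * p ^ ?A\<close>, which exceeds \<open>ord g = p ^ ?B * m\<close>.\<close>
      let ?g = "g [^] (p ^ ?B)"
      have gG: "?g \<in> carrier G"
        using g(1) by simp
      have ord_g: "ord ?g = m"
        using ord_pow[OF g(1) multiplicity_dvd] p m(1)
        by (metis nonzero_mult_div_cancel_left not_prime_0 power_not_zero)
      have cop: "coprime m (p ^ ?A)"
        using prime_imp_coprime[OF p m(2)] by (simp add: coprime_commute)
      have pows: "?g [^] m = \<one>" "h [^] (p ^ ?A) = \<one>"
        using pow_ord_eq_1[OF gG] pow_ord_eq_1[OF hG] ord_g ord_h by simp_all
      have comm: "?g \<otimes> h = h \<otimes> ?g"
        using nilpotent_coprime_commute[OF nil gG hG pows cop] .
      have "m dvd ord (?g \<otimes> h)" "p ^ ?A dvd ord (?g \<otimes> h)"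
        using coprime_factors_mem_cyc[OF gG hG comm pows cop] ord_dvd_if_mem_cyc gG hG ord_g ord_h
        by (metis m_closed)+
      then have "m * p ^ ?A dvd ord (?g \<otimes> h)"
        using cop by (rule divides_mult)
      then have "m * p ^ ?A \<le> ord g"
        using dvd_imp_le[of "m * p ^ ?A" "ord (?g \<otimes> h)"] ord_pos[of "?g \<otimes> h"] g gG hG
        by (meson le_trans m_closed)
      moreover have "p ^ ?B < p ^ ?A"
        using less p prime_gt_1_nat by (intro power_strict_increasing) auto
      moreover have "m > 0"
        using m ord_pos[OF g(1)] by (cases m) auto
      ultimately have "m * p ^ ?B < ord g"
        by (meson mult_less_mono2 order_less_le_trans)
      then show False
        using m(1) by (simp add: mult.commute)
    qed
  qed
  then have "card (cyc g) \<ge> card (carrier G)"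
    using generate_pow_card[OF g(1)] ord_pos[OF g(1)] dvd_imp_le by (auto simp: order_def)
  then have "cyc g = carrier G"
    using fin cyc_subset[OF g(1)] by (simp add: card_seteq)
  then show ?thesis
    using g(1) by blast
qed

text \<open>Every pair lies in the cyclic group of \<open>g\<close>, so the cyclicity condition on
  edges is automatic and only incomparability remains.\<close>

lemma perfect_difference_graph_if_cyclic:
  assumes fin: "finite (carrier G)" and g: "g \<in> carrier G" "carrier G = cyc g"
  shows "perfect_graph (with_proj (difference_graph G))"
proof (rule perfect_incomparability_graph[where R = "\<lambda>x y. x \<in> cyc y"])
  have sub: "pverts (difference_graph G) \<subseteq> carrier G"
    by (auto simp: pverts_difference_graph)
  then show "finite (verts (with_proj (difference_graph G)))"
    using fin finite_subset by auto
  show "x \<in> cyc z" if "x \<in> cyc y" "y \<in> cyc z" "z \<in> verts (with_proj (difference_graph G))" for x y z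
    using that sub cyc_trans by auto
  show "arcs_ends (with_proj (difference_graph G)) =
    {(x, y). x \<in> verts (with_proj (difference_graph G)) \<and> y \<in> verts (with_proj (difference_graph G)) \<and>
      x \<notin> cyc y \<and> y \<notin> cyc x}"
  proof -
    have "x \<in> cyc g" if "x \<in> carrier G" for x
      using that g(2) by metis
    then have "(x, y) \<in> parcs (difference_graph G) \<longleftrightarrow>
        x \<in> carrier G \<and> y \<in> carrier G \<and> x \<notin> cyc y \<and> y \<notin> cyc x" for x y
      using difference_graph_adj_iff g(1) by blast
    then show ?thesis
      by (auto simp: pverts_difference_graph)
  qed
qed (rule cyc_self)

end

theorem theorem7p5:
  fixes G :: "('a, 'b) monoid_scheme"
  assumes "nilpotent_group G" and "finite (carrier G)"
  shows
    "(card (prime_divisors G) \<ge> 3 \<and>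
      (\<forall>p \<in> prime_divisors G. \<forall>P. sylow_subgroup p P G \<longrightarrow> cyclic_group (G\<lparr>carrier := P\<rparr>))
        \<longrightarrow> perfect_graph (with_proj (difference_graph G))) \<and>
     (card (prime_divisors G) \<ge> 3 \<and>
      (\<exists>p \<in> prime_divisors G. \<exists>P. sylow_subgroup p P G \<and> \<not> cyclic_group (G\<lparr>carrier := P\<rparr>))
        \<longrightarrow> \<not> perfect_graph (with_proj (difference_graph G))) \<and>
     (card (prime_divisors G) = 2
        \<longrightarrow> comparability_graph (with_proj (difference_graph G)) \<and>
            perfect_graph (with_proj (difference_graph G)))"
proof (intro conjI[of "_ \<longrightarrow> _"] impI)
  interpret group G
    using assms(1) by (simp add: nilpotent_group_def)
  let ?D = "with_proj (difference_graph G)"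
  {
    assume "card (prime_divisors G) \<ge> 3 \<and>
      (\<forall>p \<in> prime_divisors G. \<forall>P. sylow_subgroup p P G \<longrightarrow> cyclic_group (G\<lparr>carrier := P\<rparr>))"
    then obtain g where "g \<in> carrier G" "carrier G = generate G {g}"
      using nilpotent_cyclic_if_sylow_cyclic[OF assms] by blast
    then show "perfect_graph ?D"
      using perfect_difference_graph_if_cyclic assms(2) by blast
  next
    assume *: "card (prime_divisors G) \<ge> 3 \<and>
      (\<exists>p \<in> prime_divisors G. \<exists>P. sylow_subgroup p P G \<and> \<not> cyclic_group (G\<lparr>carrier := P\<rparr>))"
    then obtain p P where p: "p \<in> prime_divisors G"
      and P: "sylow_subgroup p P G" "\<not> cyclic_group (G\<lparr>carrier := P\<rparr>)"
      by blast
    \<comment> \<open>Two primes besides \<open>p\<close> are required, one for each of the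
      auxiliary vertices c and d of the 5-cycle.\<close>
    have "card (prime_divisors G - {p}) \<ge> 2"
      using card_Diff_singleton[OF p] *[THEN conjunct1] by linarith
    then obtain T where "T \<subseteq> prime_divisors G - {p}" "card T = 2"
      by (rule obtain_subset_with_card_n)
    then obtain q r where "q \<in> prime_divisors G - {p}" "r \<in> prime_divisors G - {p}" "q \<noteq> r"
      by (auto simp: card_2_iff)
    then show "\<not> perfect_graph ?D"
      using not_perfect_difference_graph[OF assms, of p q r P] p P by (auto simp: prime_divisors_def)
  next
    assume "card (prime_divisors G) = 2"
    then obtain p q where pq: "prime_divisors G = {p, q}" "p \<noteq> q"
      by (auto simp: card_2_iff)
    have ord0: "order G \<noteq> 0"
      using assms(2) order_gt_0_iff_finite by auto
    then have "prime_factors (order G) = {p, q}"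
      using pq(1) by (auto simp: prime_divisors_def prime_factors_dvd)
    then have "order G = p ^ multiplicity p (order G) * q ^ multiplicity q (order G)"
      using prime_factorization_nat[of "order G"] ord0 pq(2) by simp
    moreover have "prime p" "prime q"
      using pq(1) by (auto simp: prime_divisors_def)
    ultimately have comp: "comparability_graph ?D"
      using comparability_difference_graph assms(1) pq(2) by blast
    moreover have "perfect_graph ?D"
      using comp by (rule perfect_comparability_graph)
        (use assms(2) in \<open>auto simp: pverts_difference_graph\<close>)
    ultimately show "comparability_graph ?D \<and> perfect_graph ?D"
      by blast
  }
qed

end
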